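(* Let $(\Omega,\mathcal F,\mathbb P)$ be a nonatomic probability space and $\mathcal X_c$ the set of random variables on it with compactly supported distribution. For a continuous and constant-additive mapping $\rho:\mathcal X_c\to\mathbb R$, the following are equivalent: (i) $\rho$ is o-convex and p-convex; (ii) $\rho$ is o-concave and p-concave; (iii) $\rho=k\,\mathbb E$ for some $k\in\mathbb R$.
   Context: $\mathcal M_c$ is the set of compactly supported Borel probability measures on $\mathbb R$, i.e. the set of distributions of elements of $\mathcal X_c$. Continuity is with respect to the (essential) supremum norm on $\mathcal X_c$. $\rho$ is constant-additive if $\rho(X+c)=\rho(X)+\rho(c)$ for all $X\in\mathcal X_c$, $c\in\mathbb R$. $\mathbb E$ is expectation under $\mathbb P$. $\rho$ is o-convex if $\rho(\lambda X+(1-\lambda)Y)\le\lambda\rho(X)+(1-\lambda)\rho(Y)$ for all $X,Y\in\mathcal X_c$, $\lambda\in[0,1]$; o-concave if the reverse inequality holds. $\rho$ is p-convex if it is law-based (i.e. $\rho(X)$ depends only on the distribution of $X$) and the induced functional on $\mathcal M_c$, $\rho(F):=\rho(X)$ for $X$ with distribution $F$, satisfies $\rho(\lambda F+(1-\lambda)G)\le\lambda\rho(F)+(1-\lambda)\rho(G)$ for all $F,G\in\mathcal M_c$, $\lambda\in[0,1]$; p-concave is the same with the reverse inequality. *)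

theory Defs
  imports "HOL-Probability.Probability"
begin

definition nonatomic :: "'a measure \<Rightarrow> bool" where
  "nonatomic M \<longleftrightarrow>
     (\<forall>A\<in>sets M. emeasure M A > 0 \<longrightarrow>
       (\<exists>B\<in>sets M. B \<subseteq> A \<and> 0 < emeasure M B \<and> emeasure M B < emeasure M A))"

definition supp_measure :: "'a::topological_space measure \<Rightarrow> 'a set" where
  "supp_measure F = {x. \<forall>U. open U \<and> x \<in> U \<longrightarrow> emeasure F U > 0}"

definition M_c :: "real measure set" where
  "M_c = {F. prob_space F \<and> sets F = sets borel \<and> compact (supp_measure F)}"

definition X_c :: "'a measure \<Rightarrow> ('a \<Rightarrow> real) set" where
  "X_c M = {X \<in> borel_measurable M. distr M borel X \<in> M_c}"

text \<open>Random variables are plain functions here, not classes modulo almost sure equality, so the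
  essential supremum is only a seminorm; a continuous \<open>\<rho>\<close> agrees on almost surely equal elements.
  Values of \<open>\<rho>\<close> outside \<open>X_c M\<close> are irrelevant throughout.\<close>

definition esssup_continuous :: "'a measure \<Rightarrow> (('a \<Rightarrow> real) \<Rightarrow> real) \<Rightarrow> bool" where
  "esssup_continuous M \<rho> \<longleftrightarrow>
     (\<forall>X\<in>X_c M. \<forall>\<epsilon>>0. \<exists>\<delta>>0. \<forall>Y\<in>X_c M.
        esssup M (\<lambda>\<omega>. ereal \<bar>Y \<omega> - X \<omega>\<bar>) < ereal \<delta> \<longrightarrow> \<bar>\<rho> Y - \<rho> X\<bar> < \<epsilon>)"

definition constant_additive :: "'a measure \<Rightarrow> (('a \<Rightarrow> real) \<Rightarrow> real) \<Rightarrow> bool" where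
  "constant_additive M \<rho> \<longleftrightarrow>
     (\<forall>X\<in>X_c M. \<forall>c. \<rho> (\<lambda>\<omega>. X \<omega> + c) = \<rho> X + \<rho> (\<lambda>\<omega>. c))"

definition o_convex :: "'a measure \<Rightarrow> (('a \<Rightarrow> real) \<Rightarrow> real) \<Rightarrow> bool" where
  "o_convex M \<rho> \<longleftrightarrow>
     (\<forall>X\<in>X_c M. \<forall>Y\<in>X_c M. \<forall>t\<in>{0..1}.
        \<rho> (\<lambda>\<omega>. t * X \<omega> + (1 - t) * Y \<omega>) \<le> t * \<rho> X + (1 - t) * \<rho> Y)"

definition o_concave :: "'a measure \<Rightarrow> (('a \<Rightarrow> real) \<Rightarrow> real) \<Rightarrow> bool" where
  "o_concave M \<rho> \<longleftrightarrow>
     (\<forall>X\<in>X_c M. \<forall>Y\<in>X_c M. \<forall>t\<in>{0..1}.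
        \<rho> (\<lambda>\<omega>. t * X \<omega> + (1 - t) * Y \<omega>) \<ge> t * \<rho> X + (1 - t) * \<rho> Y)"

definition law_based :: "'a measure \<Rightarrow> (('a \<Rightarrow> real) \<Rightarrow> real) \<Rightarrow> bool" where
  "law_based M \<rho> \<longleftrightarrow>
     (\<forall>X\<in>X_c M. \<forall>Y\<in>X_c M. distr M borel X = distr M borel Y \<longrightarrow> \<rho> X = \<rho> Y)"

text \<open>The choice is independent of the representative when \<open>\<rho>\<close> is law-based; on a nonatomic
  probability space every element of \<open>M_c\<close> is the distribution of some element of \<open>X_c M\<close>.\<close>

definition induced :: "'a measure \<Rightarrow> (('a \<Rightarrow> real) \<Rightarrow> real) \<Rightarrow> real measure \<Rightarrow> real" where
  "induced M \<rho> F = \<rho> (SOME X. X \<in> X_c M \<and> distr M borel X = F)"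

definition mixture :: "real \<Rightarrow> real measure \<Rightarrow> real measure \<Rightarrow> real measure" where
  "mixture t F G = measure_of UNIV (sets borel)
     (\<lambda>A. ennreal t * emeasure F A + ennreal (1 - t) * emeasure G A)"

lemma sets_mixture [simp, measurable_cong]: "sets (mixture t F G) = sets borel"
  using sets.sigma_sets_eq[of "borel :: real measure"] by (simp add: mixture_def)

lemma emeasure_mixture:
  assumes F: "sets F = sets borel" and G: "sets G = sets borel" and A: "A \<in> sets borel"
  shows "emeasure (mixture t F G) A = ennreal t * emeasure F A + ennreal (1 - t) * emeasure G A"
proof (rule emeasure_measure_of[OF mixture_def])
  show "countably_additive (sets (mixture t F G))
    (\<lambda>A. ennreal t * emeasure F A + ennreal (1 - t) * emeasure G A)"
  proof (rule countably_additiveI)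
    fix B :: "nat \<Rightarrow> real set"
    assume B: "range B \<subseteq> sets (mixture t F G)" "disjoint_family B"
    have "(\<Sum>i. emeasure F (B i)) = emeasure F (\<Union>i. B i)"
      "(\<Sum>i. emeasure G (B i)) = emeasure G (\<Union>i. B i)"
      using B F G by (auto intro!: suminf_emeasure)
    then show "(\<Sum>i. ennreal t * emeasure F (B i) + ennreal (1 - t) * emeasure G (B i)) =
      ennreal t * emeasure F (\<Union>i. B i) + ennreal (1 - t) * emeasure G (\<Union>i. B i)"
      by (simp flip: suminf_add add: ennreal_suminf_cmult)
  qed
qed (use A in \<open>auto simp: positive_def\<close>)

definition p_convex :: "'a measure \<Rightarrow> (('a \<Rightarrow> real) \<Rightarrow> real) \<Rightarrow> bool" where
  "p_convex M \<rho> \<longleftrightarrow> law_based M \<rho> \<and>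
     (\<forall>F\<in>M_c. \<forall>G\<in>M_c. \<forall>t\<in>{0..1}.
        induced M \<rho> (mixture t F G) \<le> t * induced M \<rho> F + (1 - t) * induced M \<rho> G)"

definition p_concave :: "'a measure \<Rightarrow> (('a \<Rightarrow> real) \<Rightarrow> real) \<Rightarrow> bool" where
  "p_concave M \<rho> \<longleftrightarrow> law_based M \<rho> \<and>
     (\<forall>F\<in>M_c. \<forall>G\<in>M_c. \<forall>t\<in>{0..1}.
        induced M \<rho> (mixture t F G) \<ge> t * induced M \<rho> F + (1 - t) * induced M \<rho> G)"

end

theory Submission
  imports Defs
begin

text \<open>
  If \<open>\<rho>\<close> is o-convex and constant-additive, then \<open>\<rho>(c) = k c\<close> on constants. Decomposing a finitely
  supported law into point masses, p-convexity gives \<open>\<rho>(X) \<le> k E X\<close> for simple \<open>X\<close>, and by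
  continuity for all \<open>X\<close>. Then \<open>0 = \<rho>(0) \<le> (\<rho>(X) + \<rho>(-X)) / 2\<close> by o-convexity, so
  \<open>\<rho>(X) \<ge> -\<rho>(-X) \<ge> k E X\<close>. The concave case is the convex one for \<open>-\<rho>\<close>. Conversely, \<open>k E\<close> is affine
  for both kinds of mixing as soon as every law in \<open>M_c\<close> is the distribution of some random
  variable; such variables are read off a maximal chain of events, which in a nonatomic space
  attains every probability exactly once.
\<close>

section \<open>Maximal chains of events in a nonatomic probability space\<close>

text \<open>The measures must differ strictly: otherwise the supremum of a chain need not be comparable
  with the members that exceed it by a null set.\<close>

definition subset_less :: "'a measure \<Rightarrow> 'a set \<Rightarrow> 'a set \<Rightarrow> bool" where
  "subset_less M A B \<longleftrightarrow> A \<subseteq> B \<and> measure M A < measure M B"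

text \<open>A member of largest measure, if there is one, serves as \<open>L\<close>. Otherwise
  \<open>L\<close> is the union of a sequence in \<open>S\<close> whose measures approach the
  supremum; it absorbs each member of \<open>S\<close>, because in the chain a strictly larger
  measure forces inclusion. So a possibly uncountable union reduces to a countable one. The empty
  chain gets \<open>L = {}\<close>, whence \<open>0 \<le> r\<close>.\<close>

lemma (in prob_space) chain_upper_bound:
  assumes S: "S \<subseteq> sets M" and le: "\<And>A. A \<in> S \<Longrightarrow> measure M A \<le> r" and r: "0 \<le> r"
    and chain: "\<And>A B. A \<in> S \<Longrightarrow> B \<in> S \<Longrightarrow> A = B \<or> subset_less M A B \<or> subset_less M B A"
  obtains L where "L \<in> sets M" "measure M L \<le> r" "L \<subseteq> \<Union>S"
    "\<And>A. A \<in> S \<Longrightarrow> A \<subseteq> L" "\<And>A. A \<in> S \<Longrightarrow> A \<noteq> L \<Longrightarrow> measure M A < measure M L"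
proof (cases "\<exists>A\<in>S. \<forall>B\<in>S. measure M B \<le> measure M A")
  case True
  then obtain A where A: "A \<in> S" "\<And>B. B \<in> S \<Longrightarrow> measure M B \<le> measure M A" by blast
  show thesis
  proof (rule that[of A])
    show "B \<subseteq> A" "B \<noteq> A \<Longrightarrow> measure M B < measure M A" if "B \<in> S" for B
      using chain[OF that A(1)] A(2)[OF that] by (auto simp: subset_less_def)
  qed (use A S le in auto)
next
  case False
  show thesis
  proof (cases "S = {}")
    case True
    then show thesis using r by (intro that[of "{}"]) auto
  next
    case ne: False
    define a where "a = (SUP A\<in>S. measure M A)"
    have bdd: "bdd_above (measure M ` S)" by (intro bdd_aboveI2[of _ _ 1]) simp
    have lt: "measure M A < a" if "A \<in> S" for A
    proof -
      from False that obtain B where "B \<in> S" "measure M A < measure M B" by force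
      then show ?thesis unfolding a_def using cSUP_upper[OF \<open>B \<in> S\<close> bdd] by linarith
    qed
    have "\<exists>A\<in>S. a - 1 / Suc n < measure M A" for n
      using less_cSUP_iff[OF ne bdd, of "a - 1 / Suc n"] by (simp add: a_def)
    then obtain f where f: "\<And>n. f n \<in> S" "\<And>n::nat. a - 1 / Suc n < measure M (f n)" by metis
    \<comment> \<open>Finite unions of members of a chain are again members, so the bound
      \<open>r\<close> applies to each \<open>g n\<close>, and continuity from below carries it over
      to \<open>L\<close>.\<close>
    define g where "g n = (\<Union>i\<le>n. f i)" for n
    have g: "g n \<in> S" for n
    proof (induction n)
      case (Suc n)
      have "g (Suc n) = f (Suc n) \<union> g n" by (simp add: g_def atMost_Suc)
      with Suc chain[OF f(1)[of "Suc n"] Suc] f(1)[of "Suc n"] show ?case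
        by (auto simp: subset_less_def Un_absorb1 Un_absorb2)
    qed (simp add: g_def f)
    define L where "L = (\<Union>n. f n)"
    have L: "L \<in> sets M" using f(1) S by (auto simp: L_def)
    have "(\<lambda>n. measure M (g n)) \<longlonglongrightarrow> measure M (\<Union>n. g n)"
      using g S by (intro finite_Lim_measure_incseq) (auto simp: incseq_def g_def intro!: exI order_trans)
    also have "(\<Union>n. g n) = L" by (auto simp: g_def L_def)
    finally have "measure M L \<le> r"
      by (rule LIMSEQ_le_const2) (use g le in auto)
    have "f n \<subseteq> L" for n by (auto simp: L_def)
    then have aL: "a - 1 / Suc n < measure M L" for n
      using finite_measure_mono[OF _ L, of "f n"] f(2)[of n] by (meson order_less_le_trans)
    have aL: "a \<le> measure M L"
    proof (rule field_le_epsilon)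
      fix e :: real assume "0 < e"
      then obtain n where "1 / Suc n < e" by (rule nat_approx_posE)
      with aL[of n] show "a \<le> measure M L + e" by linarith
    qed
    show thesis
    proof (rule that[of L])
      fix A assume A: "A \<in> S"
      show "measure M A < measure M L" using lt[OF A] aL by simp
      have "\<exists>n. measure M A < a - 1 / Suc n"
        using lt[OF A] reals_Archimedean[of "a - measure M A"] by (auto simp: inverse_eq_divide algebra_simps)
      then obtain n where "measure M A < measure M (f n)" using f(2) by (meson less_trans)
      then have "A \<subseteq> f n" using chain[OF A f(1)[of n]] by (auto simp: subset_less_def)
      then show "A \<subseteq> L" by (auto simp: L_def)
    qed (use L \<open>measure M L \<le> r\<close> f in \<open>auto simp: L_def\<close>)
  qed
qed

text \<open>Hausdorff's principle gives a maximal chain \<open>C\<close>. If it skipped a measure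
  \<open>r\<close>, its members below and above \<open>r\<close> would leave a gap between events
  \<open>L\<close> and \<open>U\<close>, and either one of these or an event strictly between them
  could be added to \<open>C\<close>.\<close>

lemma (in prob_space) nonatomic_chain:
  assumes na: "nonatomic M"
  obtains B where "\<And>r. r \<in> {0..1} \<Longrightarrow> B r \<in> sets M" "\<And>r. r \<in> {0..1} \<Longrightarrow> measure M (B r) = r"
    "\<And>r s. 0 \<le> r \<Longrightarrow> r \<le> s \<Longrightarrow> s \<le> 1 \<Longrightarrow> B r \<subseteq> B s"
proof -
  obtain C where C: "pred_on.maxchain (sets M) (subset_less M) C"
    using pred_on.Hausdorff by blast
  have CM: "C \<subseteq> sets M"
    and tot: "\<And>A B. A \<in> C \<Longrightarrow> B \<in> C \<Longrightarrow> A = B \<or> subset_less M A B \<or> subset_less M B A"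
    using C by (auto simp: pred_on.maxchain_def pred_on.chain_def)
  have max: "D \<in> C" if "D \<in> sets M" "\<And>A. A \<in> C \<Longrightarrow> subset_less M A D \<or> subset_less M D A" for D
  proof (rule ccontr)
    assume "D \<notin> C"
    have "pred_on.chain (sets M) (subset_less M) (insert D C)"
      using that CM tot unfolding pred_on.chain_def by auto
    with C \<open>D \<notin> C\<close> show False by (auto simp: pred_on.maxchain_def)
  qed
  have "\<exists>A\<in>C. measure M A = r" if r: "r \<in> {0..1}" for r
  proof (rule ccontr)
    assume no: "\<not> (\<exists>A\<in>C. measure M A = r)"
    define Lo where "Lo = {A\<in>C. measure M A < r}"
    define Hi where "Hi = {A\<in>C. r < measure M A}"
    have CC: "A \<in> Lo \<or> A \<in> Hi" if "A \<in> C" for A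
      using no that by (force simp: Lo_def Hi_def)
    obtain L where L: "L \<in> sets M" "measure M L \<le> r" "L \<subseteq> \<Union>Lo"
      "\<And>A. A \<in> Lo \<Longrightarrow> A \<subseteq> L" "\<And>A. A \<in> Lo \<Longrightarrow> A \<noteq> L \<Longrightarrow> measure M A < measure M L"
    proof (rule chain_upper_bound[of Lo r])
    qed (use CM tot r in \<open>auto simp: Lo_def\<close>)
    \<comment> \<open>Complements turn lower bounds into upper bounds, so the same lemma yields
      \<open>U\<close> as a measurable lower bound of \<open>Hi\<close>.\<close>
    obtain U' where U': "U' \<in> sets M" "measure M U' \<le> 1 - r" "U' \<subseteq> \<Union>((\<lambda>A. space M - A) ` Hi)"
      "\<And>A. A \<in> (\<lambda>A. space M - A) ` Hi \<Longrightarrow> A \<subseteq> U'"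
      "\<And>A. A \<in> (\<lambda>A. space M - A) ` Hi \<Longrightarrow> A \<noteq> U' \<Longrightarrow> measure M A < measure M U'"
    proof (rule chain_upper_bound[of "(\<lambda>A. space M - A) ` Hi" "1 - r"])
      fix A B assume "A \<in> (\<lambda>A. space M - A) ` Hi" "B \<in> (\<lambda>A. space M - A) ` Hi"
      then obtain A' B' where AB: "A' \<in> C" "B' \<in> C" "A = space M - A'" "B = space M - B'"
        by (auto simp: Hi_def)
      then show "A = B \<or> subset_less M A B \<or> subset_less M B A"
        using tot[OF AB(1,2)] CM by (auto simp: subset_less_def prob_compl subset_iff)
    qed (use CM r in \<open>auto simp: Hi_def prob_compl subset_iff\<close>)
    define U where "U = space M - U'"
    have U: "U \<in> sets M" "r \<le> measure M U" using U' by (auto simp: U_def prob_compl)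
    have UA: "U \<subseteq> A" "A \<noteq> U \<Longrightarrow> measure M U < measure M A" if "A \<in> Hi" for A
    proof -
      have A: "A \<in> sets M" "A \<subseteq> space M" using that CM sets.sets_into_space by (auto simp: Hi_def)
      show "U \<subseteq> A" using U'(4)[of "space M - A"] that A by (auto simp: U_def)
      assume "A \<noteq> U"
      then have "space M - A \<noteq> U'" using A by (auto simp: U_def)
      then show "measure M U < measure M A"
        using U'(5)[of "space M - A"] that A U'(1) by (simp add: U_def prob_compl)
    qed
    \<comment> \<open>Each member of \<open>Lo\<close> lies inside each member of \<open>Hi\<close>,
      while \<open>L\<close> stays within the union of \<open>Lo\<close> and \<open>U\<close>
      contains all points common to \<open>Hi\<close>.\<close>
    have LU: "L \<subseteq> U"
    proof
      fix x assume "x \<in> L"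
      then obtain A where A: "A \<in> Lo" "x \<in> A" using L(3) by blast
      have "x \<in> D" if "D \<in> Hi" for D
        using A that tot[of A D] by (auto simp: Lo_def Hi_def subset_less_def)
      moreover have "x \<in> space M" using \<open>x \<in> L\<close> L(1) sets.sets_into_space by blast
      ultimately show "x \<in> U" using U'(3) by (auto simp: U_def)
    qed
    \<comment> \<open>An event filling the gap is strictly comparable with all of \<open>C\<close>,
      so maximality puts it into \<open>C\<close>.\<close>
    have mid: "D \<in> C" if D: "D \<in> sets M" "L \<subseteq> D" "D \<subseteq> U"
      "\<And>A. A \<in> Lo \<Longrightarrow> measure M A < measure M D" "\<And>A. A \<in> Hi \<Longrightarrow> measure M D < measure M A" for D
    proof (rule max[OF D(1)])
      fix A assume "A \<in> C"
      then show "subset_less M A D \<or> subset_less M D A"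
        using CC[of A] D L(4)[of A] UA(1)[of A] by (auto simp: subset_less_def)
    qed
    have "measure M L \<noteq> r"
      using mid[of L] LU L(1) no by (auto simp: Lo_def Hi_def)
    moreover have "measure M U \<noteq> r"
      using mid[of U] LU U(1) no by (auto simp: Lo_def Hi_def)
    ultimately have lt: "measure M L < r" "r < measure M U" using L(2) U(2) by auto
    have UL: "measure M (U - L) = measure M U - measure M L"
      using LU L(1) U(1) by (intro finite_measure_Diff) auto
    \<comment> \<open>The gap \<open>U - L\<close> has positive measure, and nonatomicity cuts a
      proper piece \<open>E\<close> out of it. Then \<open>L \<union> E\<close> must belong to
      \<open>C\<close>, although its measure exceeds all those in \<open>Lo\<close> and is below all
      those in \<open>Hi\<close>.\<close>
    obtain E where E: "E \<in> sets M" "E \<subseteq> U - L" "0 < emeasure M E" "emeasure M E < emeasure M (U - L)"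
      using na[unfolded nonatomic_def, rule_format, of "U - L"] lt UL L(1) U(1)
      by (auto simp: emeasure_eq_measure)
    have DE: "measure M (L \<union> E) = measure M L + measure M E"
      using E L(1) by (intro finite_measure_Union) auto
    have D: "measure M L < measure M (L \<union> E)" "measure M (L \<union> E) < measure M U"
      using E(3,4) UL DE by (auto simp: emeasure_eq_measure ennreal_less_iff)
    have le: "measure M A \<le> measure M L" if "A \<in> Lo" for A
      using finite_measure_mono[OF L(4)[OF that] L(1)] .
    have ge: "measure M U \<le> measure M A" if "A \<in> Hi" for A
      using finite_measure_mono[OF UA(1)[OF that]] that CM by (auto simp: Hi_def)
    have "L \<union> E \<in> C"
    proof (rule mid)
      show "L \<union> E \<in> sets M" "L \<subseteq> L \<union> E" "L \<union> E \<subseteq> U" using L(1) E LU by auto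
      show "measure M A < measure M (L \<union> E)" if "A \<in> Lo" for A using le[OF that] D by linarith
      show "measure M (L \<union> E) < measure M A" if "A \<in> Hi" for A using ge[OF that] D by linarith
    qed
    with CC have "L \<union> E \<in> Lo \<or> L \<union> E \<in> Hi" by blast
    then show False using le ge D by force
  qed
  then obtain B where B: "\<And>r. r \<in> {0..1} \<Longrightarrow> B r \<in> C" "\<And>r. r \<in> {0..1} \<Longrightarrow> measure M (B r) = r"
    by metis
  show thesis
  proof (rule that[of B])
    fix r s :: real assume rs: "0 \<le> r" "r \<le> s" "s \<le> 1"
    then show "B r \<subseteq> B s"
      using tot[of "B r" "B s"] B[of r] B[of s] by (auto simp: subset_less_def)
  qed (use B CM in auto)
qed

section \<open>Supports, compactly supported laws and bounded random variables\<close>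

lemma closed_supp_measure: "closed (supp_measure F)"
proof -
  have "- supp_measure F = \<Union>{U. open U \<and> emeasure F U = 0}"
    by (auto simp: supp_measure_def)
  moreover have "open (\<Union>{U. open U \<and> emeasure F U = 0})" by (intro open_Union) auto
  ultimately show ?thesis by (simp add: closed_def)
qed

text \<open>The complement of the support is the union of all open null sets; by the Lindelof
  property countably many of them cover it.\<close>

lemma AE_supp_measure:
  fixes F :: "'a::second_countable_topology measure"
  assumes F: "sets F = sets borel"
  shows "AE x in F. x \<in> supp_measure F"
proof -
  obtain \<V> where V: "\<V> \<subseteq> {U. open U \<and> emeasure F U = 0}" "countable \<V>"
    "\<Union>\<V> = \<Union>{U. open U \<and> emeasure F U = 0}"
    by (rule Lindelof[of "{U. open U \<and> emeasure F U = 0}"]) auto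
  have "(\<Union>V\<in>\<V>. V) \<in> null_sets F"
    using V by (intro null_sets_UN') (auto simp: null_sets_def F)
  then have "\<Union>\<V> \<in> null_sets F" by simp
  then show ?thesis
    by (rule AE_I') (use V(3) in \<open>auto simp: supp_measure_def\<close>)
qed

text \<open>Replaces the support by an almost sure bound, the form used from here on. A bound on the
  support holds almost surely since the support carries the law; conversely
  \<open>{x. c < \<bar>x\<bar>}\<close> is an open null set and hence misses the support, which is
  closed.\<close>

lemma M_c_iff:
  "F \<in> M_c \<longleftrightarrow> prob_space F \<and> sets F = sets borel \<and> (\<exists>c. AE x in F. \<bar>x\<bar> \<le> c)"
proof (intro iffI conjI; (elim conjE exE)?)
  assume F: "F \<in> M_c"
  then show "prob_space F" "sets F = sets borel" by (auto simp: M_c_def)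
  obtain c where "\<And>x. x \<in> supp_measure F \<Longrightarrow> \<bar>x\<bar> \<le> c"
    using F compact_imp_bounded[of "supp_measure F"] by (auto simp: M_c_def bounded_real)
  then show "\<exists>c. AE x in F. \<bar>x\<bar> \<le> c"
    using AE_supp_measure[OF \<open>sets F = sets borel\<close>] by (intro exI[of _ c]) (auto elim!: eventually_mono)
next
  fix c assume F: "prob_space F" "sets F = sets borel" and c: "AE x in F. \<bar>x\<bar> \<le> c"
  have "emeasure F {x. c < \<bar>x\<bar>} = 0"
    using c AE_iff_measurable[of "{x. c < \<bar>x\<bar>}" F "\<lambda>x. \<bar>x\<bar> \<le> c"] F(2)
    by (auto simp: not_le sets_eq_imp_space_eq[OF F(2)])
  moreover have "open {x::real. c < \<bar>x\<bar>}" by (intro open_Collect_less continuous_intros)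
  ultimately have "\<bar>x\<bar> \<le> c" if "x \<in> supp_measure F" for x
    using that by (force simp: supp_measure_def)
  then have "bounded (supp_measure F)" by (auto simp: bounded_real)
  then show "F \<in> M_c" using F closed_supp_measure by (auto simp: M_c_def compact_eq_bounded_closed)
qed

context prob_space
begin

lemma X_c_iff: "X \<in> X_c M \<longleftrightarrow> X \<in> borel_measurable M \<and> (\<exists>c. AE \<omega> in M. \<bar>X \<omega>\<bar> \<le> c)"
proof (cases "X \<in> borel_measurable M")
  case [measurable]: True
  show ?thesis by (simp add: X_c_def M_c_iff prob_space_distr AE_distr_iff)
qed (simp add: X_c_def)

lemma integrable_X_c: "X \<in> X_c M \<Longrightarrow> integrable M X"
  unfolding X_c_iff by (elim conjE exE, rule integrable_const_bound) auto

lemma const_X_c: "(\<lambda>_. c) \<in> X_c M"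
  unfolding X_c_iff by (intro conjI exI[of _ "\<bar>c\<bar>"]) auto

lemma minus_X_c: "X \<in> X_c M \<Longrightarrow> (\<lambda>\<omega>. - X \<omega>) \<in> X_c M"
  by (auto simp: X_c_iff)

end

lemma integrable_M_c:
  assumes F: "F \<in> M_c"
  shows "integrable F (\<lambda>x. x)"
proof -
  obtain c where "prob_space F" "sets F = sets borel" and c: "AE x in F. \<bar>x\<bar> \<le> c"
    using F by (auto simp: M_c_iff)
  interpret prob_space F by fact
  note [measurable_cong] = \<open>sets F = sets borel\<close>
  show ?thesis using c by (intro integrable_const_bound[of _ c]) auto
qed

section \<open>Mixtures of laws and integration against them\<close>

lemma space_mixture [simp]: "space (mixture t F G) = UNIV"
  using sets_eq_imp_space_eq[OF sets_mixture] by simp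

lemma AE_mixture:
  assumes F: "sets F = sets borel" and G: "sets G = sets borel" and P: "Measurable.pred borel P"
    and "AE x in F. P x" "AE x in G. P x"
  shows "AE x in mixture t F G. P x"
proof -
  have "{x. \<not> P x} \<in> sets borel" using P by measurable
  moreover have "emeasure F {x. \<not> P x} = 0" "emeasure G {x. \<not> P x} = 0"
    using assms AE_iff_measurable[OF _ refl, of F P] AE_iff_measurable[OF _ refl, of G P]
      \<open>{x. \<not> P x} \<in> sets borel\<close> sets_eq_imp_space_eq[OF F] sets_eq_imp_space_eq[OF G]
    by auto
  ultimately show ?thesis
    by (intro AE_I[of _ _ "{x. \<not> P x}"]) (auto simp: emeasure_mixture F G)
qed

lemma prob_space_mixture:
  assumes F: "prob_space F" "sets F = sets borel" and G: "prob_space G" "sets G = sets borel"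
    and t: "t \<in> {0..1}"
  shows "prob_space (mixture t F G)"
proof
  have "emeasure F UNIV = 1" "emeasure G UNIV = 1"
    using F(1) G(1) sets_eq_imp_space_eq[OF F(2)] sets_eq_imp_space_eq[OF G(2)]
    by (auto dest: prob_space.emeasure_space_1)
  then show "emeasure (mixture t F G) (space (mixture t F G)) = 1"
    using F G t by (simp add: emeasure_mixture flip: ennreal_plus)
qed

lemma mixture_M_c:
  assumes F: "F \<in> M_c" and G: "G \<in> M_c" and t: "t \<in> {0..1}"
  shows "mixture t F G \<in> M_c"
proof -
  obtain c d where "AE x in F. \<bar>x\<bar> \<le> c" "AE x in G. \<bar>x\<bar> \<le> d" using F G by (auto simp: M_c_iff)
  then have "AE x in F. \<bar>x\<bar> \<le> max c d" "AE x in G. \<bar>x\<bar> \<le> max c d" by (auto elim: eventually_mono)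
  then have "AE x in mixture t F G. \<bar>x\<bar> \<le> max c d"
    using F G by (intro AE_mixture) (auto simp: M_c_iff)
  then show ?thesis using F G t prob_space_mixture by (auto simp: M_c_iff)
qed

text \<open>Induction over nonnegative measurable functions from indicators upwards. In the limit
  step the supremum of the sum splits because both summands increase.\<close>

lemma nn_integral_mixture:
  assumes F: "sets F = sets borel" and G: "sets G = sets borel" and f: "f \<in> borel_measurable borel"
  shows "(\<integral>\<^sup>+x. f x \<partial>mixture t F G) =
    ennreal t * (\<integral>\<^sup>+x. f x \<partial>F) + ennreal (1 - t) * (\<integral>\<^sup>+x. f x \<partial>G)"
  using f
proof (induction rule: borel_measurable_induct)
  case (cong f g)
  then have "f = g" by auto
  with cong show ?case by simp
next
  case (set A) then show ?case by (simp add: F G emeasure_mixture)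
next
  note [measurable_cong] = F G
  case (mult u c)
  note [measurable] = \<open>u \<in> borel_measurable borel\<close>
  from mult show ?case by (simp add: nn_integral_cmult algebra_simps)
next
  note [measurable_cong] = F G
  case (add u v)
  note [measurable] = \<open>u \<in> borel_measurable borel\<close> \<open>v \<in> borel_measurable borel\<close>
  from add show ?case by (simp add: nn_integral_add algebra_simps)
next
  note [measurable_cong] = F G
  case (seq U)
  note [measurable] = \<open>\<And>i. U i \<in> borel_measurable borel\<close>
  have mono: "incseq (\<lambda>i. integral\<^sup>N N (U i))" for N :: "real measure"
    using \<open>incseq U\<close> by (auto simp: incseq_def le_fun_def intro!: nn_integral_mono)
  have *: "(\<integral>\<^sup>+x. (SUP i. U i) x \<partial>N) = (SUP i. integral\<^sup>N N (U i))"
    if [measurable_cong]: "sets N = sets borel" for N :: "real measure"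
    unfolding SUP_apply by (intro nn_integral_monotone_convergence_SUP \<open>incseq U\<close>) measurable
  have i: "incseq (\<lambda>i. ennreal s * integral\<^sup>N N (U i))" for s and N :: "real measure"
    using mono[of N] by (auto simp: incseq_def intro: mult_left_mono)
  show ?case
    unfolding *[OF sets_mixture] *[OF F] *[OF G]
    by (simp add: seq.IH SUP_mult_left_ennreal ennreal_SUP_add[OF i i])
qed

lemma integral_mixture:
  assumes F: "F \<in> M_c" and G: "G \<in> M_c" and t: "t \<in> {0..1}"
  shows "(\<integral>x. x \<partial>mixture t F G) = t * (\<integral>x. x \<partial>F) + (1 - t) * (\<integral>x. x \<partial>G)"
proof -
  have fin: "(\<integral>\<^sup>+x. ennreal x \<partial>N) < top" "(\<integral>\<^sup>+x. ennreal (- x) \<partial>N) < top" if "N \<in> M_c" for N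
    using integrable_M_c[OF that] by (auto simp: real_integrable_def less_top)
  \<comment> \<open>Finiteness is essential: \<open>enn2real\<close> sends \<open>top\<close> to 0
    and is additive only on finite values.\<close>
  have *: "enn2real (ennreal t * a + ennreal (1 - t) * b) = t * enn2real a + (1 - t) * enn2real b"
    if "a < top" "b < top" for a b :: ennreal
    using that t by (simp add: enn2real_plus enn2real_mult ennreal_mult_less_top)
  have s: "sets F = sets borel" "sets G = sets borel" using F G by (auto simp: M_c_iff)
  show ?thesis
    unfolding real_lebesgue_integral_def[OF integrable_M_c[OF F]]
      real_lebesgue_integral_def[OF integrable_M_c[OF G]]
      real_lebesgue_integral_def[OF integrable_M_c[OF mixture_M_c[OF F G t]]]
    by (simp add: nn_integral_mixture s * fin F G) (simp add: algebra_simps)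
qed

section \<open>Realizing every compactly supported law by a random variable\<close>

context prob_space
begin

text \<open>Needed to evaluate \<open>induced\<close> on arbitrary laws, in particular on mixtures:
  without a random variable of law \<open>F\<close> its choice would be unspecified.\<close>

lemma ex_X_c_distr:
  assumes na: "nonatomic M" and F: "F \<in> M_c"
  obtains X where "X \<in> X_c M" "distr M borel X = F"
proof -
  obtain B where B: "\<And>r. r \<in> {0..1} \<Longrightarrow> B r \<in> sets M" "\<And>r. r \<in> {0..1} \<Longrightarrow> measure M (B r) = r"
    "\<And>r s. 0 \<le> r \<Longrightarrow> r \<le> s \<Longrightarrow> s \<le> 1 \<Longrightarrow> B r \<subseteq> B s"
    using nonatomic_chain[OF na] by blast
  interpret F: real_distribution F
    using F by (auto simp: M_c_iff real_distribution_def real_distribution_axioms_def)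
  obtain c0 where c0: "AE x in F. \<bar>x\<bar> \<le> c0" using F by (auto simp: M_c_iff)
  \<comment> \<open>Nonnegativity of \<open>c\<close> keeps the default value \<open>c\<close> in
    \<open>S\<close> above the lower bound \<open>- c\<close>.\<close>
  define c where "c = max c0 0"
  have c: "AE x in F. \<bar>x\<bar> \<le> c" using c0 by eventually_elim (simp add: c_def)
  have "0 \<le> c" by (simp add: c_def)
  have C01: "cdf F x \<in> {0..1}" for x using F.cdf_nonneg F.cdf_bounded_prob by auto
  have low: "cdf F x = 0" if "x < - c" for x
  proof -
    have "AE y in F. y \<notin> {..x}" using c by eventually_elim (use that in auto)
    then show ?thesis by (subst cdf_def, subst F.prob_eq_0) auto
  qed
  have high: "cdf F x = 1" if "c \<le> x" for x
  proof -
    have "AE y in F. y \<in> {..x}" using c by eventually_elim (use that in auto)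
    then show ?thesis by (subst cdf_def, subst F.prob_eq_1) auto
  qed
  \<comment> \<open>\<open>X\<close> is the quantile transform of the chain: \<open>{X \<le> x}\<close> agrees with \<open>B (cdf F x)\<close> up to a null
    set; inserting \<open>c\<close> keeps the infimum away from the empty set.\<close>
  define S where "S \<omega> = insert c {x. - c \<le> x \<and> \<omega> \<in> B (cdf F x)}" for \<omega>
  define X where "X \<omega> = Inf (S \<omega>)" for \<omega>
  have S: "S \<omega> \<noteq> {}" "bdd_below (S \<omega>)" for \<omega>
    using \<open>0 \<le> c\<close> by (auto simp: S_def intro!: bdd_belowI[of _ "- c"])
  have Xc: "X \<omega> \<le> c" for \<omega>
    unfolding X_def by (rule cInf_lower) (use S in \<open>auto simp: S_def\<close>)
  have Xc': "- c \<le> X \<omega>" for \<omega>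
    unfolding X_def by (rule cInf_greatest) (use S \<open>0 \<le> c\<close> in \<open>auto simp: S_def\<close>)
  have X_less: "X \<omega> < s \<longleftrightarrow> (\<exists>x\<in>S \<omega>. x < s)" for \<omega> s
    unfolding X_def by (rule cInf_less_iff[OF S])
  have mono: "B (cdf F x) \<subseteq> B (cdf F y)" if "x \<le> y" for x y
    using B(3) C01[of x] C01[of y] F.cdf_nondecreasing[OF that] by auto
  \<comment> \<open>Since \<open>B (cdf F x)\<close> grows with \<open>x\<close>, rational
    thresholds suffice; the union becomes countable and \<open>X\<close> measurable.\<close>
  have less_eq: "{\<omega>\<in>space M. X \<omega> < s} =
      (if c < s then space M else space M \<inter> (\<Union>x\<in>{x\<in>\<rat>. - c \<le> x \<and> x < s}. B (cdf F x)))" for s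
  proof (cases "c < s")
    case False
    have "(\<exists>x\<in>S \<omega>. x < s) \<longleftrightarrow> (\<exists>x\<in>{x\<in>\<rat>. - c \<le> x \<and> x < s}. \<omega> \<in> B (cdf F x))" for \<omega>
    proof
      assume "\<exists>x\<in>S \<omega>. x < s"
      then obtain x where x: "- c \<le> x" "\<omega> \<in> B (cdf F x)" "x < s" using False by (auto simp: S_def)
      obtain q where "q \<in> \<rat>" "x < q" "q < s" using Rats_dense_in_real[OF \<open>x < s\<close>] by blast
      then show "\<exists>x\<in>{x\<in>\<rat>. - c \<le> x \<and> x < s}. \<omega> \<in> B (cdf F x)"
        using x mono[of x q] by (intro bexI[of _ q]) auto
    qed (auto simp: S_def)
    then show ?thesis using False by (auto simp: X_less)
  qed (use Xc in \<open>auto intro: le_less_trans\<close>)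
  have meas[measurable]: "X \<in> borel_measurable M"
    unfolding borel_measurable_iff_less less_eq using B(1)[OF C01]
    by (auto intro!: sets.countable_UN' sets.Int countable_subset[OF _ countable_rat])
  have "cdf (distr M borel X) = cdf F"
  proof
    fix x
    have eq: "cdf (distr M borel X) x = measure M {\<omega>\<in>space M. X \<omega> \<le> x}"
      by (auto simp: cdf_def measure_distr vimage_def Int_def intro!: arg_cong[where f="measure M"])
    consider "x < - c" | "c \<le> x" | "- c \<le> x" "x < c" by linarith
    then show "cdf (distr M borel X) x = cdf F x"
    proof cases
      case 1
      then have empty: "{\<omega>\<in>space M. X \<omega> \<le> x} = {}" using Xc' by (auto simp: not_le intro: less_le_trans)
      show ?thesis unfolding eq empty low[OF 1] by simp
    next
      case 2
      then have full: "{\<omega>\<in>space M. X \<omega> \<le> x} = space M" using Xc by (auto intro: order_trans)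
      show ?thesis unfolding eq full high[OF 2] by (rule prob_space)
    next
      case 3
      have "B (cdf F x) \<subseteq> {\<omega>\<in>space M. X \<omega> \<le> x}"
        using sets.sets_into_space[OF B(1)[OF C01]] 3
        by (auto simp: X_def S_def intro!: cInf_lower S[unfolded S_def])
      then have "measure M (B (cdf F x)) \<le> measure M {\<omega>\<in>space M. X \<omega> \<le> x}"
        by (intro finite_measure_mono) auto
      then have 1: "cdf F x \<le> cdf (distr M borel X) x" by (simp add: eq B(2)[OF C01])
      \<comment> \<open>The infimum \<open>X \<omega>\<close> need not be attained, so the upper
        estimate holds only for \<open>y\<close> beyond \<open>x\<close>; right-continuity of
        \<open>cdf F\<close> then closes the gap.\<close>
      have "cdf (distr M borel X) x \<le> cdf F y" if y: "x < y" for y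
      proof (cases "y < c")
        case True
        have "{\<omega>\<in>space M. X \<omega> \<le> x} \<subseteq> B (cdf F y)"
        proof safe
          fix \<omega> assume "X \<omega> \<le> x"
          then obtain z where "z \<in> S \<omega>" "z < y" using X_less[of \<omega> y] y by auto
          then show "\<omega> \<in> B (cdf F y)" using mono[of z y] True by (auto simp: S_def)
        qed
        then have "measure M {\<omega>\<in>space M. X \<omega> \<le> x} \<le> measure M (B (cdf F y))"
          by (intro finite_measure_mono B C01)
        then show ?thesis by (simp add: eq B(2)[OF C01])
      next
        case False
        then show ?thesis using high[of y] by (simp add: eq)
      qed
      then have "cdf (distr M borel X) x \<le> cdf F x"
        using F.cdf_is_right_cont[of x]
        by (intro tendsto_lowerbound[of "cdf F" _ "at_right x"])
          (auto simp: continuous_within eventually_at_filter intro!: always_eventually)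
      with 1 show ?thesis by simp
    qed
  qed
  then have "distr M borel X = F"
    by (intro cdf_unique) (auto intro: F.real_distribution_axioms)
  moreover have "X \<in> X_c M"
    unfolding X_c_iff using Xc Xc' by (auto intro!: exI[of _ c] AE_I2 simp: abs_le_iff minus_le_iff)
  ultimately show thesis using that by blast
qed


section \<open>Convexity in both senses forces a multiple of the expectation\<close>

lemma induced_distr:
  assumes "law_based M \<rho>" and X: "X \<in> X_c M"
  shows "induced M \<rho> (distr M borel X) = \<rho> X"
proof -
  define Y where "Y = (SOME Y. Y \<in> X_c M \<and> distr M borel Y = distr M borel X)"
  have "Y \<in> X_c M \<and> distr M borel Y = distr M borel X"
    unfolding Y_def by (rule someI[of _ X]) (use X in simp)
  then have "\<rho> Y = \<rho> X" using assms unfolding law_based_def by blast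
  then show ?thesis unfolding induced_def Y_def .
qed

text \<open>On constants \<open>\<rho>\<close> is additive, hence odd. Convexity against 0 gives
  \<open>f (t * a) \<le> t * f a\<close>; the same inequality at \<open>- a\<close> reverses it, so
  homogeneity follows without continuity.\<close>

lemma constant_additive_o_convex_const:
  assumes add: "constant_additive M \<rho>" and conv: "o_convex M \<rho>"
  shows "\<rho> (\<lambda>_. c) = c * \<rho> (\<lambda>_. 1)"
proof -
  define f where "f c = \<rho> (\<lambda>_. c)" for c
  have f_add: "f (a + b) = f a + f b" for a b
    using add const_X_c by (simp add: constant_additive_def f_def)
  have f0: "f 0 = 0" using f_add[of 0 0] by simp
  have neg: "f (- a) = - f a" for a using f_add[of a "- a"] f0 by simp
  have le: "f (t * a) \<le> t * f a" if "t \<in> {0..1}" for t a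
    using conv[unfolded o_convex_def, rule_format, OF const_X_c const_X_c that, of a 0] f0
    by (simp add: f_def)
  have eq: "f (t * a) = t * f a" if "t \<in> {0..1}" for t a
    using le[OF that, of a] le[OF that, of "- a"] neg by (simp add: neg)
  have pos: "f c = c * f 1" if "0 \<le> c" for c
  proof (cases "c \<le> 1")
    case False
    then show ?thesis using eq[of "1 / c" c] by (simp add: field_simps)
  qed (use eq[of c 1] that in simp)
  have "f c = c * f 1"
    using pos[of c] pos[of "- c"] neg[of c] by (cases "0 \<le> c") auto
  then show ?thesis by (simp add: f_def)
qed

text \<open>The induction stays on the level of laws, so no random variable with the conditioned law \<open>G\<close> is
  needed.\<close>

lemma p_convex_finite_support_le:
  assumes p: "p_convex M \<rho>" and const: "\<And>c. \<rho> (\<lambda>_. c) = c * k"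
    and "finite S" and "F \<in> M_c" and "AE x in F. x \<in> S"
  shows "induced M \<rho> F \<le> k * (\<integral>x. x \<partial>F)"
  using assms(3-5)
proof (induction S arbitrary: F rule: finite_induct)
  case empty
  then interpret F: prob_space F by (simp add: M_c_iff)
  from empty show ?case using F.AE_False by simp
next
  case (insert x S)
  interpret F: prob_space F using insert.prems by (simp add: M_c_iff)
  have sF[simp, measurable_cong]: "sets F = sets borel" using insert.prems by (simp add: M_c_iff)
  have spF[simp]: "space F = UNIV" using sets_eq_imp_space_eq[OF sF] by simp
  have delta: "return borel x = distr M borel (\<lambda>_. x)" by (simp add: distr_const)
  then have dM: "return borel x \<in> M_c" using const_X_c[of x] by (auto simp: X_c_def)
  have dI: "induced M \<rho> (return borel x) = k * x"
    unfolding delta using p by (subst induced_distr[OF _ const_X_c]) (auto simp: p_convex_def const)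
  have dE: "(\<integral>y. y \<partial>return borel x) = x" by (simp add: integral_return)
  have S[measurable]: "S \<in> sets borel"
    using \<open>finite S\<close> by (simp add: finite_imp_closed borel_closed)
  have split: "emeasure F A = emeasure F {x} * indicator A x + emeasure F (S \<inter> A)"
    if [measurable]: "A \<in> sets borel" for A
  proof -
    have "emeasure F A = emeasure F (({x} \<inter> A) \<union> (S \<inter> A))"
      using insert.prems(2) by (intro emeasure_eq_AE) (auto elim!: eventually_mono)
    also have "\<dots> = emeasure F ({x} \<inter> A) + emeasure F (S \<inter> A)"
      using insert.hyps by (intro plus_emeasure[symmetric]) auto
    finally show ?thesis by (auto simp: indicator_def)
  qed
  define t where "t = measure F {x}"
  have t: "t \<in> {0..1}" by (simp add: t_def)
  have St: "measure F S = 1 - t"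
    using split[of UNIV] F.emeasure_space_1
    by (simp add: F.emeasure_eq_measure t_def flip: ennreal_plus)
  show ?case
  proof (cases "t = 1")
    \<comment> \<open>All mass sits at \<open>x\<close>, so conditioning on \<open>S\<close> is
      impossible and \<open>F\<close> is a point mass.\<close>
    case True
    have "F = return borel x"
    proof (rule measure_eqI)
      fix A assume "A \<in> sets F"
      then have A[measurable]: "A \<in> sets borel" by simp
      have "emeasure F (S \<inter> A) \<le> emeasure F S" by (intro emeasure_mono) auto
      then have "emeasure F (S \<inter> A) = 0" using St True by (simp add: F.emeasure_eq_measure)
      then show "emeasure F A = emeasure (return borel x) A"
        using split[OF A] True by (simp add: F.emeasure_eq_measure[of "{x}"] t_def)
    qed simp
    then show ?thesis using dI dE by simp
  next
    case False
    \<comment> \<open>\<open>G\<close> is \<open>F\<close> conditioned on \<open>S\<close>.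
      Splitting off the atom at \<open>x\<close> writes \<open>F\<close> as a mixture of a point
      mass and a law on the smaller set \<open>S\<close>.\<close>
    define G where "G = uniform_measure F S"
    have pos: "measure F S > 0" using St False t by simp
    have sG: "sets G = sets borel" by (simp add: G_def)
    have eG: "emeasure G A = emeasure F (S \<inter> A) / emeasure F S" if "A \<in> sets borel" for A
      using that by (simp add: G_def emeasure_uniform_measure)
    have "prob_space G"
      unfolding G_def using pos by (intro prob_space_uniform_measure) (auto simp: F.emeasure_eq_measure)
    moreover have AEG: "AE y in G. y \<in> S"
      unfolding G_def by (intro AE_uniform_measureI) auto
    moreover obtain c where "AE y in G. \<bar>y\<bar> \<le> c"
    proof
      show "AE y in G. \<bar>y\<bar> \<le> Max (insert 0 (abs ` S))"
        using AEG by eventually_elim (use \<open>finite S\<close> in \<open>auto intro: Max_ge\<close>)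
    qed
    ultimately have G: "G \<in> M_c" using sG by (auto simp: M_c_iff)
    have F_eq: "F = mixture t (return borel x) G"
    proof (rule measure_eqI)
      fix A assume "A \<in> sets F"
      then have A[measurable]: "A \<in> sets borel" by simp
      have "ennreal (1 - t) * emeasure G A = emeasure F (S \<inter> A)"
        using pos by (simp add: eG A F.emeasure_eq_measure St[symmetric] divide_ennreal flip: ennreal_mult)
      then show "emeasure F A = emeasure (mixture t (return borel x) G) A"
        using split[OF A] t by (simp add: emeasure_mixture sG F.emeasure_eq_measure[of "{x}"] t_def)
    qed simp
    have "induced M \<rho> F \<le> t * induced M \<rho> (return borel x) + (1 - t) * induced M \<rho> G"
      using p dM G t unfolding F_eq p_convex_def by blast
    also have "\<dots> \<le> t * (k * x) + (1 - t) * (k * (\<integral>y. y \<partial>G))"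
      using insert.IH[OF G AEG] t by (intro add_mono mult_left_mono) (auto simp: dI)
    also have "\<dots> = k * (\<integral>y. y \<partial>F)"
      by (subst F_eq) (simp add: integral_mixture[OF dM G t] dE algebra_simps)
    finally show ?thesis .
  qed
qed

text \<open>Rounds \<open>X\<close> down to the grid of multiples of \<open>e\<close>. Truncating to
  the almost sure range first makes \<open>Y\<close> finitely valued at every point.\<close>

lemma X_c_finite_approx:
  assumes X: "X \<in> X_c M" and e: "0 < (e::real)"
  obtains Y S where "Y \<in> X_c M" "finite S" "\<And>\<omega>. Y \<omega> \<in> S" "AE \<omega> in M. \<bar>Y \<omega> - X \<omega>\<bar> \<le> e"
proof -
  have [measurable]: "X \<in> borel_measurable M" using X by (simp add: X_c_iff)
  obtain c where c: "AE \<omega> in M. \<bar>X \<omega>\<bar> \<le> c" using X by (auto simp: X_c_iff)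
  define Y where "Y \<omega> = e * real_of_int \<lfloor>max (- c) (min c (X \<omega>)) / e\<rfloor>" for \<omega>
  define S where "S = (\<lambda>i. e * real_of_int i) ` {\<lfloor>- \<bar>c\<bar> / e\<rfloor>..\<lfloor>\<bar>c\<bar> / e\<rfloor>}"
  have S: "finite S" by (simp add: S_def)
  have YS: "Y \<omega> \<in> S" for \<omega>
  proof -
    have "- \<bar>c\<bar> / e \<le> max (- c) (min c (X \<omega>)) / e" "max (- c) (min c (X \<omega>)) / e \<le> \<bar>c\<bar> / e"
      using e by (intro divide_right_mono; linarith)+
    then show ?thesis unfolding Y_def S_def by (intro imageI) (auto intro: floor_mono)
  qed
  have [measurable]: "Y \<in> borel_measurable M" unfolding Y_def by measurable
  have "\<bar>Y \<omega>\<bar> \<le> Max (abs ` S)" for \<omega> using S YS[of \<omega>] by auto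
  then have "Y \<in> X_c M" by (auto simp: X_c_iff)
  moreover have "AE \<omega> in M. \<bar>Y \<omega> - X \<omega>\<bar> \<le> e"
    using c
  proof eventually_elim
    case (elim \<omega>)
    then have cut: "max (- c) (min c (X \<omega>)) = X \<omega>" by auto
    have "X \<omega> / e - 1 < \<lfloor>X \<omega> / e\<rfloor>" "\<lfloor>X \<omega> / e\<rfloor> \<le> X \<omega> / e" by linarith+
    then have "e * (X \<omega> / e - 1) < e * \<lfloor>X \<omega> / e\<rfloor>" "e * \<lfloor>X \<omega> / e\<rfloor> \<le> e * (X \<omega> / e)"
      using e by (auto intro: mult_left_mono mult_strict_left_mono simp del: times_divide_eq_right)
    moreover have "e * (X \<omega> / e) = X \<omega>" using e by simp
    ultimately have "X \<omega> - e < e * \<lfloor>X \<omega> / e\<rfloor>" "e * \<lfloor>X \<omega> / e\<rfloor> \<le> X \<omega>"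
      unfolding right_diff_distrib by linarith+
    then show ?case by (simp add: Y_def cut abs_le_iff)
  qed
  ultimately show thesis using that S YS by blast
qed

lemma p_convex_le_expectation:
  assumes cont: "esssup_continuous M \<rho>" and p: "p_convex M \<rho>"
    and const: "\<And>c. \<rho> (\<lambda>_. c) = c * k" and X: "X \<in> X_c M"
  shows "\<rho> X \<le> k * expectation X"
proof (rule field_le_epsilon)
  fix e :: real assume "0 < e"
  then have "0 < e / 2" by simp
  then obtain \<delta> where \<delta>: "0 < \<delta>" "\<And>Y. Y \<in> X_c M \<Longrightarrow>
      esssup M (\<lambda>\<omega>. ereal \<bar>Y \<omega> - X \<omega>\<bar>) < ereal \<delta> \<Longrightarrow> \<bar>\<rho> Y - \<rho> X\<bar> < e / 2"
    using cont X unfolding esssup_continuous_def by blast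
  \<comment> \<open>The first bound keeps the essential supremum strictly below
    \<open>\<delta>\<close>; the second makes the error in \<open>k * expectation Y\<close> at most
    \<open>e / 2\<close>, with \<open>+ 1\<close> guarding against \<open>k = 0\<close>.\<close>
  define d where "d = min (\<delta> / 2) (e / (2 * (\<bar>k\<bar> + 1)))"
  have d: "0 < d" "d < \<delta>" "d \<le> e / (2 * (\<bar>k\<bar> + 1))" using \<open>0 < e\<close> \<delta>(1) by (auto simp: d_def)
  obtain Y S where Y: "Y \<in> X_c M" "finite S" "\<And>\<omega>. Y \<omega> \<in> S" and
    YX: "AE \<omega> in M. \<bar>Y \<omega> - X \<omega>\<bar> \<le> d"
    using X_c_finite_approx[OF X d(1)] by metis
  have [measurable]: "X \<in> borel_measurable M" "Y \<in> borel_measurable M"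
    using X Y by (auto simp: X_c_iff)
  have "esssup M (\<lambda>\<omega>. ereal \<bar>Y \<omega> - X \<omega>\<bar>) \<le> ereal d"
    using YX by (intro esssup_I) auto
  then have "\<bar>\<rho> Y - \<rho> X\<bar> < e / 2"
    using d by (intro \<delta>(2) Y) (auto intro: le_less_trans)
  moreover have "\<rho> Y \<le> k * expectation Y"
  proof -
    have "S \<in> sets borel" using Y(2) by (simp add: finite_imp_closed borel_closed)
    then have "induced M \<rho> (distr M borel Y) \<le> k * (\<integral>x. x \<partial>distr M borel Y)"
      using Y by (intro p_convex_finite_support_le[OF p const, of S]) (auto simp: X_c_def AE_distr_iff)
    then show ?thesis using p Y(1) by (simp add: induced_distr p_convex_def integral_distr)
  qed
  moreover have "k * expectation Y \<le> k * expectation X + e / 2"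
  proof -
    note i = integrable_X_c[OF X] integrable_X_c[OF Y(1)]
    have "\<bar>expectation Y - expectation X\<bar> \<le> expectation (\<lambda>\<omega>. \<bar>Y \<omega> - X \<omega>\<bar>)"
      using i integral_abs_bound[of M "\<lambda>\<omega>. Y \<omega> - X \<omega>"] by simp
    also have "\<dots> \<le> expectation (\<lambda>_. d)" using i YX by (intro integral_mono_AE) auto
    finally have "\<bar>expectation Y - expectation X\<bar> \<le> d" by (simp add: prob_space)
    then have "\<bar>k\<bar> * \<bar>expectation Y - expectation X\<bar> \<le> (\<bar>k\<bar> + 1) * d"
      by (intro mult_mono) auto
    also have "\<dots> \<le> e / 2" using d(3) by (simp add: field_simps)
    finally have "\<bar>k * (expectation Y - expectation X)\<bar> \<le> e / 2" by (simp add: abs_mult)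
    then have "k * (expectation Y - expectation X) \<le> e / 2" by linarith
    then show ?thesis by (simp add: algebra_simps)
  qed
  ultimately show "\<rho> X \<le> k * expectation X + e" by linarith
qed

lemma convex_imp_expectation:
  assumes cont: "esssup_continuous M \<rho>" and add: "constant_additive M \<rho>"
    and o: "o_convex M \<rho>" and p: "p_convex M \<rho>" and X: "X \<in> X_c M"
  shows "\<rho> X = \<rho> (\<lambda>_. 1) * expectation X"
proof (rule antisym)
  note const = constant_additive_o_convex_const[OF add o]
  note le = p_convex_le_expectation[OF cont p const]
  show "\<rho> X \<le> \<rho> (\<lambda>_. 1) * expectation X" by (rule le[OF X])
  \<comment> \<open>The midpoint of \<open>X\<close> and its negative is the constant 0, so the
    upper bound at the negative becomes a lower bound at \<open>X\<close>.\<close>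
  have "\<rho> (\<lambda>_. 0) \<le> 1/2 * \<rho> X + (1 - 1/2) * \<rho> (\<lambda>\<omega>. - X \<omega>)"
    using o[unfolded o_convex_def, rule_format, OF X minus_X_c[OF X], of "1/2"] by simp
  then show "\<rho> (\<lambda>_. 1) * expectation X \<le> \<rho> X"
    using le[OF minus_X_c[OF X]] const[of 0] by simp
qed


section \<open>Multiples of the expectation are affine for both kinds of mixing\<close>

lemma expectation_affine:
  assumes \<rho>: "\<And>X. X \<in> X_c M \<Longrightarrow> \<rho> X = k * expectation X"
    and X: "X \<in> X_c M" and Y: "Y \<in> X_c M"
  shows "\<rho> (\<lambda>\<omega>. t * X \<omega> + (1 - t) * Y \<omega>) = t * \<rho> X + (1 - t) * \<rho> Y"
proof -
  obtain c d where c: "AE \<omega> in M. \<bar>X \<omega>\<bar> \<le> c" and d: "AE \<omega> in M. \<bar>Y \<omega>\<bar> \<le> d"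
    using X Y by (auto simp: X_c_iff)
  have "AE \<omega> in M. \<bar>t * X \<omega> + (1 - t) * Y \<omega>\<bar> \<le> \<bar>t\<bar> * c + \<bar>1 - t\<bar> * d"
    using c d
  proof eventually_elim
    case (elim \<omega>)
    have "\<bar>t * X \<omega> + (1 - t) * Y \<omega>\<bar> \<le> \<bar>t\<bar> * \<bar>X \<omega>\<bar> + \<bar>1 - t\<bar> * \<bar>Y \<omega>\<bar>"
      using abs_triangle_ineq[of "t * X \<omega>" "(1 - t) * Y \<omega>"] by (simp add: abs_mult)
    also have "\<dots> \<le> \<bar>t\<bar> * c + \<bar>1 - t\<bar> * d" using elim by (intro add_mono mult_left_mono) auto
    finally show ?case .
  qed
  moreover have "X \<in> borel_measurable M" "Y \<in> borel_measurable M" using X Y by (auto simp: X_c_iff)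
  ultimately have "(\<lambda>\<omega>. t * X \<omega> + (1 - t) * Y \<omega>) \<in> X_c M" by (auto simp: X_c_iff)
  then show ?thesis
    using integrable_X_c[OF X] integrable_X_c[OF Y] X Y by (simp add: \<rho> algebra_simps)
qed

text \<open>The expectation is the mean of the law. Nonatomicity enters in the second claim, where
  \<open>F\<close> must be the law of some random variable.\<close>

lemma induced_expectation:
  assumes na: "nonatomic M" and \<rho>: "\<And>X. X \<in> X_c M \<Longrightarrow> \<rho> X = k * expectation X"
  shows "law_based M \<rho>" and "F \<in> M_c \<Longrightarrow> induced M \<rho> F = k * (\<integral>x. x \<partial>F)"
proof -
  have E: "expectation X = (\<integral>x. x \<partial>distr M borel X)" if "X \<in> X_c M" for X
    using that by (simp add: X_c_iff integral_distr)
  show law: "law_based M \<rho>" by (simp add: law_based_def \<rho> E)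
  assume "F \<in> M_c"
  then obtain X where "X \<in> X_c M" "distr M borel X = F" using ex_X_c_distr[OF na] by blast
  then show "induced M \<rho> F = k * (\<integral>x. x \<partial>F)" using induced_distr[OF law, of X] \<rho> E by simp
qed

lemma expectation_imp_convex_concave:
  assumes na: "nonatomic M" and \<rho>: "\<And>X. X \<in> X_c M \<Longrightarrow> \<rho> X = k * expectation X"
  shows "o_convex M \<rho>" "p_convex M \<rho>" "o_concave M \<rho>" "p_concave M \<rho>"
proof -
  show "o_convex M \<rho>" "o_concave M \<rho>"
    using expectation_affine[OF \<rho>] by (auto simp: o_convex_def o_concave_def)
  have "induced M \<rho> (mixture t F G) = t * induced M \<rho> F + (1 - t) * induced M \<rho> G"
    if "F \<in> M_c" "G \<in> M_c" "t \<in> {0..1}" for F G t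
  proof -
    have induced: "induced M \<rho> H = k * (\<integral>x. x \<partial>H)" if "H \<in> M_c" for H
      using induced_expectation(2)[OF na] \<rho> that by blast
    show ?thesis
      unfolding induced[OF mixture_M_c[OF that]] induced[OF that(1)] induced[OF that(2)]
        integral_mixture[OF that]
      by (simp add: algebra_simps)
  qed
  then show "p_convex M \<rho>" "p_concave M \<rho>"
    using induced_expectation(1)[OF na \<rho>] by (auto simp: p_convex_def p_concave_def)
qed

end

section \<open>The concave case by a change of sign, and the equivalence\<close>

lemma uminus_functional:
  shows "esssup_continuous M \<rho> \<Longrightarrow> esssup_continuous M (\<lambda>X. - \<rho> X)"
    and "constant_additive M \<rho> \<Longrightarrow> constant_additive M (\<lambda>X. - \<rho> X)"
    and "o_concave M \<rho> \<Longrightarrow> o_convex M (\<lambda>X. - \<rho> X)"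
    and "p_concave M \<rho> \<Longrightarrow> p_convex M (\<lambda>X. - \<rho> X)"
proof -
  have "\<bar>\<rho> X - \<rho> Y\<bar> = \<bar>\<rho> Y - \<rho> X\<bar>" for X Y by simp
  then show "esssup_continuous M \<rho> \<Longrightarrow> esssup_continuous M (\<lambda>X. - \<rho> X)"
    by (simp add: esssup_continuous_def)
  show "constant_additive M \<rho> \<Longrightarrow> constant_additive M (\<lambda>X. - \<rho> X)"
    by (simp add: constant_additive_def)
  have neg: "- a \<le> t * - b + (1 - t) * - c \<longleftrightarrow> t * b + (1 - t) * c \<le> a" for a b c t :: real
    by (simp add: algebra_simps)
  show "o_concave M \<rho> \<Longrightarrow> o_convex M (\<lambda>X. - \<rho> X)"
    unfolding o_convex_def o_concave_def neg .
  have law: "law_based M (\<lambda>X. - \<rho> X) \<longleftrightarrow> law_based M \<rho>"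
    unfolding law_based_def neg_equal_iff_equal ..
  \<comment> \<open>Negation passes through \<open>induced\<close>, since its chosen representative
    depends on the law alone and not on \<open>\<rho>\<close>.\<close>
  show "p_concave M \<rho> \<Longrightarrow> p_convex M (\<lambda>X. - \<rho> X)"
    unfolding p_convex_def p_concave_def law induced_def neg .
qed

theorem proposition6:
  fixes M :: "'a measure" and \<rho> :: "('a \<Rightarrow> real) \<Rightarrow> real"
  assumes "prob_space M" and "nonatomic M"
    and "esssup_continuous M \<rho>" and "constant_additive M \<rho>"
  shows "(o_convex M \<rho> \<and> p_convex M \<rho> \<longleftrightarrow> o_concave M \<rho> \<and> p_concave M \<rho>) \<and>
    (o_concave M \<rho> \<and> p_concave M \<rho> \<longleftrightarrow>
      (\<exists>k::real. \<forall>X\<in>X_c M. \<rho> X = k * (\<integral>\<omega>. X \<omega> \<partial>M)))"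
proof -
  interpret prob_space M by fact
  let ?lin = "\<exists>k::real. \<forall>X\<in>X_c M. \<rho> X = k * (\<integral>\<omega>. X \<omega> \<partial>M)"
  have "o_convex M \<rho> \<and> p_convex M \<rho> \<Longrightarrow> ?lin"
    using convex_imp_expectation[OF assms(3,4)] by blast
  moreover have "?lin" if "o_concave M \<rho> \<and> p_concave M \<rho>"
  proof (intro exI ballI)
    fix X assume "X \<in> X_c M"
    then have "- \<rho> X = - \<rho> (\<lambda>_. 1) * expectation X"
      using that assms(3,4) by (intro convex_imp_expectation uminus_functional) auto
    then show "\<rho> X = \<rho> (\<lambda>_. 1) * expectation X" by simp
  qed
  moreover have "?lin \<Longrightarrow> o_convex M \<rho> \<and> p_convex M \<rho> \<and> o_concave M \<rho> \<and> p_concave M \<rho>"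
    using expectation_imp_convex_concave[OF assms(2)] by blast
  ultimately show ?thesis by blast
qed

end
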